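(* Let $G$ be a group and let $R$ be a commutative $G$-graded ring with nonzero unity. Then $R$ is a graded radically principal ring if and only if every graded prime ideal of $R$ is graded radically principal.
   Context: All rings are commutative with a nonzero unity $1$. $G$ is a group with identity $e$. A ring $R$ is $G$-graded if $R=\bigoplus_{g\in G}R_g$ with additive subgroups $R_g$ satisfying $R_gR_h\subseteq R_{gh}$ for all $g,h\in G$; for $x\in R$, $x_g$ denotes the component of $x$ in $R_g$, and $h(R)=\bigcup_{g\in G}R_g$ is the set of homogeneous elements. An ideal $I$ of $R$ is graded if $I=\bigoplus_{g\in G}(I\cap R_g)$. For a graded ideal $I$, the graded radical is $\mathrm{Grad}(I)=\{x=\sum_{g\in G}x_g\in R:\text{ for all }g\in G\text{ there exists a positive integer }n_g\text{ with }x_g^{n_g}\in I\}$ (so $\mathrm{Grad}(R)=R$). $\langle c\rangle$ denotes the ideal generated by $c$. A graded ideal $I$ of $R$ is graded radically principal if $\mathrm{Grad}(I)=\mathrm{Grad}(\langle c\rangle)$ for some $c\in h(R)$. The graded ring $R$ is graded radically principal if every graded ideal of $R$ is graded radically principal. A proper graded ideal $P$ of $R$ is graded prime if whenever $x,y\in h(R)$ satisfy $xy\in P$, then $x\in P$ or $y\in P$. *)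

theory Defs
  imports "HOL-Algebra.Algebra"
begin

text \<open>
  \<open>f\<close> is a decomposition of \<open>x\<close> along the family \<open>(A i)\<close>, \<open>i \<in> I\<close>: it picks \<open>f i \<in> A i\<close>, with
  finite support and sum \<open>x\<close>.  The sum ranges over the support because \<^const>\<open>finsum\<close> takes a
  junk value on infinite index sets; \<^const>\<open>PiE\<close> makes \<open>f\<close> unique as a function on the whole type.
\<close>

definition is_decomposition ::
  "('r, 'm) ring_scheme \<Rightarrow> 'i set \<Rightarrow> ('i \<Rightarrow> 'r set) \<Rightarrow> 'r \<Rightarrow> ('i \<Rightarrow> 'r) \<Rightarrow> bool" where
  "is_decomposition R I A x f \<longleftrightarrow>
     f \<in> PiE I A \<and>
     finite {i \<in> I. f i \<noteq> \<zero>\<^bsub>R\<^esub>} \<and>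
     x = (\<Oplus>\<^bsub>R\<^esub>i \<in> {i \<in> I. f i \<noteq> \<zero>\<^bsub>R\<^esub>}. f i)"

text \<open>\<open>M\<close> is the internal direct sum of the additive subgroups \<open>A i\<close>, \<open>i \<in> I\<close>.\<close>

definition internal_direct_sum ::
  "('r, 'm) ring_scheme \<Rightarrow> 'i set \<Rightarrow> ('i \<Rightarrow> 'r set) \<Rightarrow> 'r set \<Rightarrow> bool" where
  "internal_direct_sum R I A M \<longleftrightarrow>
     (\<forall>i\<in>I. additive_subgroup (A i) R) \<and>
     M = {x. \<exists>f. is_decomposition R I A x f} \<and>
     (\<forall>x\<in>M. \<exists>!f. is_decomposition R I A x f)"

text \<open>\<open>G\<close> need not be abelian; \<open>A g\<close> is the homogeneous part \<open>R\<^sub>g\<close>.\<close>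

locale graded_ring = G?: group G + R?: cring R
  for G :: "('g, 'n) monoid_scheme" (structure)
    and R :: "('r, 'm) ring_scheme" (structure)
    and A :: "'g \<Rightarrow> 'r set" +
  assumes one_not_zero: "\<one>\<^bsub>R\<^esub> \<noteq> \<zero>\<^bsub>R\<^esub>"
    and direct_sum: "internal_direct_sum R (carrier G) A (carrier R)"
    and mult_closed: "\<And>g h x y. \<lbrakk>g \<in> carrier G; h \<in> carrier G; x \<in> A g; y \<in> A h\<rbrakk>
                        \<Longrightarrow> x \<otimes>\<^bsub>R\<^esub> y \<in> A (g \<otimes>\<^bsub>G\<^esub> h)"

definition component ::
  "('g, 'n) monoid_scheme \<Rightarrow> ('r, 'm) ring_scheme \<Rightarrow> ('g \<Rightarrow> 'r set) \<Rightarrow> 'r \<Rightarrow> 'g \<Rightarrow> 'r" where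
  "component G R A x = (THE f. is_decomposition R (carrier G) A x f)"

definition homogeneous_elements :: "('g, 'n) monoid_scheme \<Rightarrow> ('g \<Rightarrow> 'r set) \<Rightarrow> 'r set" where
  "homogeneous_elements G A = (\<Union>g \<in> carrier G. A g)"

definition graded_ideal ::
  "('g, 'n) monoid_scheme \<Rightarrow> ('r, 'm) ring_scheme \<Rightarrow> ('g \<Rightarrow> 'r set) \<Rightarrow> 'r set \<Rightarrow> bool" where
  "graded_ideal G R A I \<longleftrightarrow>
     ideal I R \<and> internal_direct_sum R (carrier G) (\<lambda>g. I \<inter> A g) I"

definition graded_radical ::
  "('g, 'n) monoid_scheme \<Rightarrow> ('r, 'm) ring_scheme \<Rightarrow> ('g \<Rightarrow> 'r set) \<Rightarrow> 'r set \<Rightarrow> 'r set" where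
  "graded_radical G R A I =
     {x \<in> carrier R. \<forall>g \<in> carrier G. \<exists>n::nat. n > 0 \<and> component G R A x g [^]\<^bsub>R\<^esub> n \<in> I}"

definition graded_radically_principal_ideal ::
  "('g, 'n) monoid_scheme \<Rightarrow> ('r, 'm) ring_scheme \<Rightarrow> ('g \<Rightarrow> 'r set) \<Rightarrow> 'r set \<Rightarrow> bool" where
  "graded_radically_principal_ideal G R A I \<longleftrightarrow>
     graded_ideal G R A I \<and>
     (\<exists>c \<in> homogeneous_elements G A.
        graded_radical G R A I = graded_radical G R A (Idl\<^bsub>R\<^esub> {c}))"

definition graded_radically_principal_ring ::
  "('g, 'n) monoid_scheme \<Rightarrow> ('r, 'm) ring_scheme \<Rightarrow> ('g \<Rightarrow> 'r set) \<Rightarrow> bool" where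
  "graded_radically_principal_ring G R A \<longleftrightarrow>
     (\<forall>I. graded_ideal G R A I \<longrightarrow> graded_radically_principal_ideal G R A I)"

definition graded_prime_ideal ::
  "('g, 'n) monoid_scheme \<Rightarrow> ('r, 'm) ring_scheme \<Rightarrow> ('g \<Rightarrow> 'r set) \<Rightarrow> 'r set \<Rightarrow> bool" where
  "graded_prime_ideal G R A P \<longleftrightarrow>
     graded_ideal G R A P \<and> P \<noteq> carrier R \<and>
     (\<forall>x \<in> homogeneous_elements G A. \<forall>y \<in> homogeneous_elements G A.
        x \<otimes>\<^bsub>R\<^esub> y \<in> P \<longrightarrow> x \<in> P \<or> y \<in> P)"

end

theory Submission
  imports Defs
begin

text \<open>
  An Oka-type argument.  If some graded ideal is not graded radically principal, Zorn's lemma gives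
  a maximal one \<open>P\<close>: along a chain, a homogeneous \<open>c\<close> generating the union up to radical has a power
  in some member of the chain, which is then already radically generated by \<open>c\<close>.
  If \<open>P\<close> were not graded prime, say \<open>x y \<in> P\<close> with \<open>x, y \<notin> P\<close> homogeneous, then \<open>P + (x)\<close> and
  \<open>P + (y)\<close> would be radically generated by homogeneous \<open>a\<close> and \<open>b\<close>; since the product of these
  two ideals lies in \<open>P\<close>, the product \<open>a b\<close> would radically generate \<open>P\<close>.
\<close>

context graded_ring
begin

section \<open>Decompositions and homogeneous components\<close>

text \<open>The definition sums over the exact support. Allowing any finite \<open>S\<close> that
  contains it makes it unnecessary to determine the supports of sums and products, where
  cancellation may occur.\<close>

lemma is_decompositionI:
  assumes "f \<in> PiE I B" "finite S" "S \<subseteq> I" "\<And>i. i \<in> I - S \<Longrightarrow> f i = \<zero>\<^bsub>R\<^esub>"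
    and "\<And>i. i \<in> I \<Longrightarrow> B i \<subseteq> carrier R" "x = finsum R f S"
  shows "is_decomposition R I B x f"
proof -
  have sub: "{i \<in> I. f i \<noteq> \<zero>\<^bsub>R\<^esub>} \<subseteq> S" using assms(4) by blast
  have fS: "f \<in> S \<rightarrow> carrier R" using assms(1,3,5) by (blast dest: PiE_mem)
  have "finsum R f S = finsum R f {i \<in> I. f i \<noteq> \<zero>\<^bsub>R\<^esub>}"
    by (rule R.add.finprod_mono_neutral_cong_right) (use assms(2-4) sub fS in auto)
  with assms(1,2,6) sub show ?thesis
    unfolding is_decomposition_def using finite_subset by auto
qed

lemma additive_subgroup_part: "g \<in> carrier G \<Longrightarrow> additive_subgroup (A g) R"
  using direct_sum by (simp add: internal_direct_sum_def)

lemma part_subset: "g \<in> carrier G \<Longrightarrow> A g \<subseteq> carrier R"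
  using additive_subgroup.a_subset additive_subgroup_part by blast

lemma zero_in_part: "g \<in> carrier G \<Longrightarrow> \<zero>\<^bsub>R\<^esub> \<in> A g"
  using additive_subgroup.zero_closed additive_subgroup_part by blast

lemma homogeneous_closed: "x \<in> homogeneous_elements G A \<Longrightarrow> x \<in> carrier R"
  using part_subset by (auto simp: homogeneous_elements_def)

lemma homogeneous_mult:
  "\<lbrakk>x \<in> homogeneous_elements G A; y \<in> homogeneous_elements G A\<rbrakk>
    \<Longrightarrow> x \<otimes>\<^bsub>R\<^esub> y \<in> homogeneous_elements G A"
  using mult_closed by (fastforce simp: homogeneous_elements_def)

lemma component_is_decomposition:
  assumes "x \<in> carrier R"
  shows "is_decomposition R (carrier G) A x (component G R A x)"
  using assms direct_sum theI' unfolding internal_direct_sum_def component_def by metis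

text \<open>By uniqueness, components are computed by exhibiting any decomposition; the lemmas below
  all work this way.\<close>

lemma component_eqI:
  assumes "x \<in> carrier R" "is_decomposition R (carrier G) A x f"
  shows "component G R A x = f"
  using assms direct_sum component_is_decomposition unfolding internal_direct_sum_def by metis

lemma component_in_part:
  "\<lbrakk>x \<in> carrier R; g \<in> carrier G\<rbrakk> \<Longrightarrow> component G R A x g \<in> A g"
  using component_is_decomposition by (auto simp: is_decomposition_def)

lemma component_closed:
  "\<lbrakk>x \<in> carrier R; g \<in> carrier G\<rbrakk> \<Longrightarrow> component G R A x g \<in> carrier R"
  using component_in_part part_subset by blast

lemma component_homogeneous:
  assumes "x \<in> A h" "h \<in> carrier G" "g \<in> carrier G"
  shows "component G R A x g = (if g = h then x else \<zero>\<^bsub>R\<^esub>)"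
proof -
  \<comment> \<open>The restricted abstraction is forced by \<open>PiE\<close>, whose members are
    \<open>undefined\<close> outside the index set.\<close>
  let ?f = "\<lambda>g \<in> carrier G. if g = h then x else \<zero>\<^bsub>R\<^esub>"
  have x: "x \<in> carrier R" using assms part_subset by blast
  have "is_decomposition R (carrier G) A x ?f"
    by (rule is_decompositionI[where S = "{h}"])
      (use assms x part_subset zero_in_part in auto)
  from component_eqI[OF x this] assms show ?thesis by simp
qed

lemma component_add:
  assumes x: "x \<in> carrier R" and y: "y \<in> carrier R" and "g \<in> carrier G"
  shows "component G R A (x \<oplus>\<^bsub>R\<^esub> y) g = component G R A x g \<oplus>\<^bsub>R\<^esub> component G R A y g"
proof -
  let ?cx = "component G R A x" and ?cy = "component G R A y"
  let ?f = "\<lambda>g \<in> carrier G. ?cx g \<oplus>\<^bsub>R\<^esub> ?cy g"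
  let ?X = "{g \<in> carrier G. ?cx g \<noteq> \<zero>\<^bsub>R\<^esub>}" and ?Y = "{g \<in> carrier G. ?cy g \<noteq> \<zero>\<^bsub>R\<^esub>}"
  have X: "finite ?X" "x = finsum R ?cx ?X" and Y: "finite ?Y" "y = finsum R ?cy ?Y"
    using component_is_decomposition x y unfolding is_decomposition_def by blast+
  have "finsum R ?f (?X \<union> ?Y) = finsum R (\<lambda>g. ?cx g \<oplus>\<^bsub>R\<^esub> ?cy g) (?X \<union> ?Y)"
    by (rule R.finsum_cong') (auto simp: x y component_closed)
  also have "\<dots> = finsum R ?cx (?X \<union> ?Y) \<oplus>\<^bsub>R\<^esub> finsum R ?cy (?X \<union> ?Y)"
    by (rule R.finsum_addf) (auto simp: x y component_closed)
  also have "finsum R ?cx (?X \<union> ?Y) = finsum R ?cx ?X"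
    by (rule R.add.finprod_mono_neutral_cong_right) (use X Y in \<open>auto simp: x component_closed\<close>)
  also have "finsum R ?cy (?X \<union> ?Y) = finsum R ?cy ?Y"
    by (rule R.add.finprod_mono_neutral_cong_right) (use X Y in \<open>auto simp: y component_closed\<close>)
  finally have sum: "x \<oplus>\<^bsub>R\<^esub> y = finsum R ?f (?X \<union> ?Y)"
    unfolding X(2)[symmetric] Y(2)[symmetric] by (rule sym)
  have "is_decomposition R (carrier G) A (x \<oplus>\<^bsub>R\<^esub> y) ?f"
  proof (rule is_decompositionI[OF _ _ _ _ _ sum])
    show "?f \<in> PiE (carrier G) A"
      using x y component_in_part additive_subgroup.a_closed[OF additive_subgroup_part] by simp
  qed (use X Y part_subset in auto)
  from component_eqI[OF _ this] assms show ?thesis by simp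
qed

text \<open>Multiplication by \<open>x\<close> carries degree \<open>h\<close> to
  \<open>h d\<close>, and right translation by \<open>d\<close> is a bijection of the group. So the
  translated components of \<open>r\<close>, each multiplied by \<open>x\<close>, decompose the
  product. As \<open>G\<close> may be non-abelian, the inverse of \<open>d\<close> has to stand on
  the right.\<close>

lemma component_mult_homogeneous:
  assumes r: "r \<in> carrier R" and x: "x \<in> A d" and d: "d \<in> carrier G" and g: "g \<in> carrier G"
  shows "component G R A (r \<otimes>\<^bsub>R\<^esub> x) g = component G R A r (g \<otimes>\<^bsub>G\<^esub> inv\<^bsub>G\<^esub> d) \<otimes>\<^bsub>R\<^esub> x"
proof -
  let ?c = "component G R A r"
  let ?f = "\<lambda>g \<in> carrier G. ?c (g \<otimes>\<^bsub>G\<^esub> inv\<^bsub>G\<^esub> d) \<otimes>\<^bsub>R\<^esub> x"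
  let ?S = "{h \<in> carrier G. ?c h \<noteq> \<zero>\<^bsub>R\<^esub>}"
  have xR: "x \<in> carrier R" using x d part_subset by blast
  have S: "finite ?S" "r = finsum R ?c ?S"
    using component_is_decomposition r unfolding is_decomposition_def by blast+
  have cancel: "h \<otimes>\<^bsub>G\<^esub> d \<otimes>\<^bsub>G\<^esub> inv\<^bsub>G\<^esub> d = h" "h \<otimes>\<^bsub>G\<^esub> inv\<^bsub>G\<^esub> d \<otimes>\<^bsub>G\<^esub> d = h"
    if "h \<in> carrier G" for h
    using that d by (simp_all add: G.m_assoc)
  have "finsum R ?c ?S \<otimes>\<^bsub>R\<^esub> x = finsum R (\<lambda>h. ?c h \<otimes>\<^bsub>R\<^esub> x) ?S"
    using S(1) xR by (intro R.finsum_ldistr) (auto simp: r component_closed)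
  also have "\<dots> = finsum R (\<lambda>h. ?f (h \<otimes>\<^bsub>G\<^esub> d)) ?S"
    by (rule R.finsum_cong') (auto simp: r d xR cancel component_closed)
  also have "\<dots> = finsum R ?f ((\<lambda>h. h \<otimes>\<^bsub>G\<^esub> d) ` ?S)"
    by (rule R.finsum_reindex[symmetric])
      (use d in \<open>auto simp: r xR component_closed intro!: inj_onI\<close>)
  finally have sum: "r \<otimes>\<^bsub>R\<^esub> x = finsum R ?f ((\<lambda>h. h \<otimes>\<^bsub>G\<^esub> d) ` ?S)"
    using S(2) by simp
  have "is_decomposition R (carrier G) A (r \<otimes>\<^bsub>R\<^esub> x) ?f"
  proof (rule is_decompositionI[OF _ _ _ _ _ sum])
    have "?c (h \<otimes>\<^bsub>G\<^esub> inv\<^bsub>G\<^esub> d) \<otimes>\<^bsub>R\<^esub> x \<in> A h" if h: "h \<in> carrier G" for h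
      using mult_closed[OF _ d component_in_part[OF r] x, of "h \<otimes>\<^bsub>G\<^esub> inv\<^bsub>G\<^esub> d"] h d
      by (simp add: cancel)
    then show "?f \<in> PiE (carrier G) A" by simp
    fix h assume h: "h \<in> carrier G - (\<lambda>h. h \<otimes>\<^bsub>G\<^esub> d) ` ?S"
    \<comment> \<open>A degree outside the translated support comes from a degree in which
      \<open>r\<close> has component zero.\<close>
    then have "h = h \<otimes>\<^bsub>G\<^esub> inv\<^bsub>G\<^esub> d \<otimes>\<^bsub>G\<^esub> d" by (simp add: cancel)
    with h have "h \<otimes>\<^bsub>G\<^esub> inv\<^bsub>G\<^esub> d \<notin> ?S" by blast
    with h d xR show "?f h = \<zero>\<^bsub>R\<^esub>" by simp
  qed (use S d part_subset in auto)
  from component_eqI[OF _ this] r xR g show ?thesis by simp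
qed

text \<open>The component \<open>?u\<close> of the unity in degree \<open>e\<close> fixes every
  homogeneous element: for \<open>x\<close> of degree \<open>h\<close>, compare the components of
  degree \<open>h\<close> in \<open>1 x = x\<close>. Hence \<open>?u\<close> fixes the sum of the
  components of the unity, that is \<open>?u 1 = 1\<close>.\<close>

lemma one_homogeneous: "\<one>\<^bsub>R\<^esub> \<in> homogeneous_elements G A"
proof -
  let ?c = "component G R A \<one>\<^bsub>R\<^esub>"
  let ?u = "?c \<one>\<^bsub>G\<^esub>"
  let ?S = "{h \<in> carrier G. ?c h \<noteq> \<zero>\<^bsub>R\<^esub>}"
  have S: "finite ?S" "\<one>\<^bsub>R\<^esub> = finsum R ?c ?S"
    using component_is_decomposition[OF R.one_closed] unfolding is_decomposition_def by blast+
  have uR: "?u \<in> carrier R" by (simp add: component_closed)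
  have u: "?u \<otimes>\<^bsub>R\<^esub> x = x" if "x \<in> A h" "h \<in> carrier G" for x h
  proof -
    have "x \<in> carrier R" using that part_subset by blast
    then show ?thesis
      using component_mult_homogeneous[OF R.one_closed that that(2)]
        component_homogeneous[OF that that(2)] that by simp
  qed
  have "?u \<otimes>\<^bsub>R\<^esub> finsum R ?c ?S = finsum R (\<lambda>h. ?u \<otimes>\<^bsub>R\<^esub> ?c h) ?S"
    using S(1) uR by (intro R.finsum_rdistr) (auto simp: component_closed)
  also have "\<dots> = finsum R ?c ?S"
    by (rule R.finsum_cong') (auto simp: component_closed u[OF component_in_part])
  finally have "?u = \<one>\<^bsub>R\<^esub>" using S(2) uR by simp
  then show ?thesis
    using component_in_part[OF R.one_closed G.one_closed] by (auto simp: homogeneous_elements_def)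
qed

section \<open>Graded ideals\<close>

lemma graded_idealD: "graded_ideal G R A I \<Longrightarrow> ideal I R"
  by (simp add: graded_ideal_def)

text \<open>A decomposition along the parts \<open>I \<inter> A g\<close> is also one along the
  parts \<open>A g\<close>, so uniqueness in the ring identifies it with the family of
  components.\<close>

lemma graded_ideal_component:
  assumes I: "graded_ideal G R A I" and x: "x \<in> I" and g: "g \<in> carrier G"
  shows "component G R A x g \<in> I"
proof -
  have xR: "x \<in> carrier R"
    using graded_idealD[OF I] x ideal.Icarr by fast
  obtain f where f: "is_decomposition R (carrier G) (\<lambda>g. I \<inter> A g) x f"
    using I x unfolding graded_ideal_def internal_direct_sum_def by blast
  then have "is_decomposition R (carrier G) A x f"
    by (auto simp: is_decomposition_def PiE_iff)
  with xR have "component G R A x = f" by (rule component_eqI)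
  with f g show ?thesis by (auto simp: is_decomposition_def)
qed

text \<open>Uniqueness of decompositions is inherited from the ring, and closure under components
  supplies their existence inside \<open>I\<close>.\<close>

lemma graded_idealI:
  assumes I: "ideal I R"
    and comp: "\<And>x g. \<lbrakk>x \<in> I; g \<in> carrier G\<rbrakk> \<Longrightarrow> component G R A x g \<in> I"
  shows "graded_ideal G R A I"
proof -
  interpret I: ideal I R by fact
  have sub: "additive_subgroup (I \<inter> A g) R" if "g \<in> carrier G" for g
    using R.add.subgroups_Inter_pair[OF I.a_subgroup
        additive_subgroup.a_subgroup[OF additive_subgroup_part[OF that]]]
    by (rule additive_subgroupI)
  have dec: "is_decomposition R (carrier G) (\<lambda>g. I \<inter> A g) x f \<longleftrightarrow> f = component G R A x"
    if x: "x \<in> I" for x f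
  proof
    assume "is_decomposition R (carrier G) (\<lambda>g. I \<inter> A g) x f"
    then have "is_decomposition R (carrier G) A x f"
      by (auto simp: is_decomposition_def PiE_iff)
    then show "f = component G R A x" using component_eqI x I.Icarr by auto
  next
    assume "f = component G R A x"
    with component_is_decomposition[OF I.Icarr[OF x]] comp[OF x]
    show "is_decomposition R (carrier G) (\<lambda>g. I \<inter> A g) x f"
      by (auto simp: is_decomposition_def PiE_iff)
  qed
  \<comment> \<open>The direct sum must not exceed \<open>I\<close>: finite sums of elements of
    \<open>I\<close> stay in \<open>I\<close>.\<close>
  have mem: "x \<in> I" if "is_decomposition R (carrier G) (\<lambda>g. I \<inter> A g) x f" for x f
  proof -
    have sum: "finsum R f S \<in> I" if "finite S" "\<forall>s\<in>S. f s \<in> I" for S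
      using that
    proof (induction S rule: finite_induct)
      case (insert s S)
      then have "f \<in> S \<rightarrow> carrier R" "f s \<in> carrier R" by (simp_all add: Pi_iff I.Icarr)
      with insert show ?case by simp
    qed simp
    have "\<forall>g \<in> {g \<in> carrier G. f g \<noteq> \<zero>\<^bsub>R\<^esub>}. f g \<in> I"
      using that by (simp add: is_decomposition_def PiE_iff)
    with that show ?thesis unfolding is_decomposition_def by (simp add: sum)
  qed
  have "I = {x. \<exists>f. is_decomposition R (carrier G) (\<lambda>g. I \<inter> A g) x f}"
    using dec mem by blast
  moreover have "\<forall>x\<in>I. \<exists>!f. is_decomposition R (carrier G) (\<lambda>g. I \<inter> A g) x f"
    by (simp add: dec)
  ultimately show ?thesis
    using sub I unfolding graded_ideal_def internal_direct_sum_def by blast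
qed

lemma graded_ideal_carrier: "graded_ideal G R A (carrier R)"
  by (rule graded_idealI) (auto simp: R.oneideal component_closed)

text \<open>For \<open>x\<close> of degree \<open>d\<close>, the component of \<open>p + r x\<close>
  in any degree is a component of \<open>p\<close> plus a component of \<open>r\<close> times
  \<open>x\<close>, again of the same shape.\<close>

lemma graded_ideal_add_principal:
  assumes P: "graded_ideal G R A P" and x: "x \<in> homogeneous_elements G A"
  shows "graded_ideal G R A (P <+>\<^bsub>R\<^esub> PIdl\<^bsub>R\<^esub> x)"
proof (rule graded_idealI)
  interpret P: ideal P R using P by (rule graded_idealD)
  have xR: "x \<in> carrier R" using x by (rule homogeneous_closed)
  obtain d where d: "d \<in> carrier G" "x \<in> A d"
    using x by (auto simp: homogeneous_elements_def)
  show "ideal (P <+>\<^bsub>R\<^esub> PIdl\<^bsub>R\<^esub> x) R"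
    using R.add_ideals R.cgenideal_ideal xR P.ideal_axioms by blast
  fix z g assume "z \<in> P <+>\<^bsub>R\<^esub> PIdl\<^bsub>R\<^esub> x" and g: "g \<in> carrier G"
  then obtain p r where p: "p \<in> P" and r: "r \<in> carrier R" and z: "z = p \<oplus>\<^bsub>R\<^esub> r \<otimes>\<^bsub>R\<^esub> x"
    by (auto simp: set_add_def' cgenideal_def)
  have "component G R A z g
      = component G R A p g \<oplus>\<^bsub>R\<^esub> component G R A r (g \<otimes>\<^bsub>G\<^esub> inv\<^bsub>G\<^esub> d) \<otimes>\<^bsub>R\<^esub> x"
    using p r xR g d by (simp add: z component_add component_mult_homogeneous P.Icarr)
  moreover have "component G R A r (g \<otimes>\<^bsub>G\<^esub> inv\<^bsub>G\<^esub> d) \<in> carrier R"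
    using r g d by (simp add: component_closed)
  ultimately show "component G R A z g \<in> P <+>\<^bsub>R\<^esub> PIdl\<^bsub>R\<^esub> x"
    using graded_ideal_component[OF P p g] by (auto simp: set_add_def' cgenideal_def)
qed

section \<open>Graded radicals, tested on homogeneous elements\<close>

text \<open>Membership in a graded radical is a condition on components, which are homogeneous.
  Conversely, a homogeneous element has only one component that can be nonzero, so the condition
  reduces to its own powers.\<close>

lemma graded_radical_subset_iff:
  assumes I: "ideal I R" and J: "ideal J R"
  shows "graded_radical G R A I \<subseteq> graded_radical G R A J \<longleftrightarrow>
    (\<forall>z \<in> homogeneous_elements G A. (\<exists>n::nat. n > 0 \<and> z [^]\<^bsub>R\<^esub> n \<in> I) \<longrightarrow>
      (\<exists>n::nat. n > 0 \<and> z [^]\<^bsub>R\<^esub> n \<in> J))" (is "?L \<longleftrightarrow> ?R")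
proof
  assume L: ?L
  show ?R
  proof (intro ballI impI)
    fix z assume z: "z \<in> homogeneous_elements G A" and n: "\<exists>n::nat. n > 0 \<and> z [^]\<^bsub>R\<^esub> n \<in> I"
    obtain h where h: "h \<in> carrier G" "z \<in> A h"
      using z by (auto simp: homogeneous_elements_def)
    \<comment> \<open>This serves the degrees in which \<open>z\<close> has component zero; exponent
      1 meets the demand for a positive exponent.\<close>
    have "\<exists>n::nat. n > 0 \<and> \<zero>\<^bsub>R\<^esub> [^]\<^bsub>R\<^esub> n \<in> I"
      by (rule exI[of _ 1]) (use I in \<open>simp add: ideal_def additive_subgroup.zero_closed\<close>)
    with n have "z \<in> graded_radical G R A I"
      unfolding graded_radical_def
      using homogeneous_closed[OF z] component_homogeneous[OF h(2,1)] by auto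
    with L have "\<exists>n::nat. n > 0 \<and> component G R A z h [^]\<^bsub>R\<^esub> n \<in> J"
      using h(1) unfolding graded_radical_def by blast
    then show "\<exists>n::nat. n > 0 \<and> z [^]\<^bsub>R\<^esub> n \<in> J"
      by (simp add: component_homogeneous[OF h(2,1) h(1)])
  qed
next
  assume R: ?R
  show ?L
  proof
    fix x assume x: "x \<in> graded_radical G R A I"
    then have xR: "x \<in> carrier R" by (simp add: graded_radical_def)
    have "\<exists>n::nat. n > 0 \<and> component G R A x g [^]\<^bsub>R\<^esub> n \<in> J" if g: "g \<in> carrier G" for g
    proof -
      have "component G R A x g \<in> homogeneous_elements G A"
        using component_in_part[OF xR g] g by (auto simp: homogeneous_elements_def)
      moreover have "\<exists>n::nat. n > 0 \<and> component G R A x g [^]\<^bsub>R\<^esub> n \<in> I"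
        using x g by (simp add: graded_radical_def)
      ultimately show ?thesis using R by blast
    qed
    with xR show "x \<in> graded_radical G R A J" by (simp add: graded_radical_def)
  qed
qed

text \<open>Only the generator has to be tested: if \<open>z^m = r c\<close> and \<open>c^n\<close>
  lies in \<open>J\<close>, then \<open>z^(m n) = r^n c^n\<close> lies in \<open>J\<close>.\<close>

lemma graded_radical_principal_subset_iff:
  assumes c: "c \<in> homogeneous_elements G A" and J: "ideal J R"
  shows "graded_radical G R A (Idl\<^bsub>R\<^esub> {c}) \<subseteq> graded_radical G R A J \<longleftrightarrow>
    (\<exists>n::nat. n > 0 \<and> c [^]\<^bsub>R\<^esub> n \<in> J)"
proof -
  interpret J: ideal J R by fact
  have cR: "c \<in> carrier R" using c by (rule homogeneous_closed)
  have idl: "ideal (Idl\<^bsub>R\<^esub> {c}) R" using cR by (simp add: R.genideal_ideal)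
  \<comment> \<open>Needed to apply the inclusion of radicals to \<open>c\<close> itself.\<close>
  have c1: "\<exists>n::nat. n > 0 \<and> c [^]\<^bsub>R\<^esub> n \<in> Idl\<^bsub>R\<^esub> {c}"
    by (rule exI[of _ 1]) (use cR in \<open>simp add: R.genideal_self'\<close>)
  have "\<exists>k::nat. k > 0 \<and> z [^]\<^bsub>R\<^esub> k \<in> J"
    if z: "z \<in> carrier R" and m: "m > 0" "z [^]\<^bsub>R\<^esub> m \<in> Idl\<^bsub>R\<^esub> {c}"
      and n: "n > 0" "c [^]\<^bsub>R\<^esub> n \<in> J" for z and m n :: nat
  proof (intro exI conjI)
    obtain r where r: "r \<in> carrier R" "z [^]\<^bsub>R\<^esub> m = r \<otimes>\<^bsub>R\<^esub> c"
      using m(2) cR by (auto simp: R.cgenideal_eq_genideal[symmetric] cgenideal_def)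
    have "z [^]\<^bsub>R\<^esub> (m * n) = (z [^]\<^bsub>R\<^esub> m) [^]\<^bsub>R\<^esub> n"
      using z by (simp add: R.nat_pow_pow)
    also have "\<dots> = r [^]\<^bsub>R\<^esub> n \<otimes>\<^bsub>R\<^esub> c [^]\<^bsub>R\<^esub> n"
      using r cR by (simp add: R.nat_pow_distrib)
    finally show "z [^]\<^bsub>R\<^esub> (m * n) \<in> J" using n r by (simp add: J.I_l_closed)
  qed (use m n in simp)
  then show ?thesis
    unfolding graded_radical_subset_iff[OF idl J] using c c1 homogeneous_closed by blast
qed

text \<open>The working form of the notion: the two conjuncts are the two inclusions of radicals,
  stated through powers of homogeneous elements. Writing \<open>PIdl\<close> makes members of the
  principal ideal explicit multiples of \<open>c\<close>.\<close>

lemma graded_radically_principal_ideal_iff: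
  assumes I: "graded_ideal G R A I"
  shows "graded_radically_principal_ideal G R A I \<longleftrightarrow>
    (\<exists>c \<in> homogeneous_elements G A. (\<exists>n::nat. n > 0 \<and> c [^]\<^bsub>R\<^esub> n \<in> I) \<and>
      (\<forall>z \<in> homogeneous_elements G A. (\<exists>n::nat. n > 0 \<and> z [^]\<^bsub>R\<^esub> n \<in> I) \<longrightarrow>
        (\<exists>n::nat. n > 0 \<and> z [^]\<^bsub>R\<^esub> n \<in> PIdl\<^bsub>R\<^esub> c)))"
proof -
  have "graded_radical G R A I = graded_radical G R A (Idl\<^bsub>R\<^esub> {c}) \<longleftrightarrow>
      (\<exists>n::nat. n > 0 \<and> c [^]\<^bsub>R\<^esub> n \<in> I) \<and>
      (\<forall>z \<in> homogeneous_elements G A. (\<exists>n::nat. n > 0 \<and> z [^]\<^bsub>R\<^esub> n \<in> I) \<longrightarrow>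
        (\<exists>n::nat. n > 0 \<and> z [^]\<^bsub>R\<^esub> n \<in> PIdl\<^bsub>R\<^esub> c))"
    if c: "c \<in> homogeneous_elements G A" for c
  proof -
    have cR: "c \<in> carrier R" using c by (rule homogeneous_closed)
    have idl: "ideal (Idl\<^bsub>R\<^esub> {c}) R" using cR by (simp add: R.genideal_ideal)
    show ?thesis
      unfolding set_eq_subset graded_radical_subset_iff[OF graded_idealD[OF I] idl]
        graded_radical_principal_subset_iff[OF c graded_idealD[OF I]]
        R.cgenideal_eq_genideal[OF cR]
      by blast
  qed
  then show ?thesis
    unfolding graded_radically_principal_ideal_def using I by blast
qed

text \<open>The generator is the unity, which must be known to be homogeneous. This later makes a
  non-principal graded ideal proper.\<close>

lemma graded_radically_principal_carrier: "graded_radically_principal_ideal G R A (carrier R)"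
proof -
  have "z [^]\<^bsub>R\<^esub> (1::nat) \<in> PIdl\<^bsub>R\<^esub> \<one>\<^bsub>R\<^esub>" if "z \<in> homogeneous_elements G A" for z
    using homogeneous_closed[OF that] by (auto simp: cgenideal_def intro!: exI[of _ z])
  moreover have "\<one>\<^bsub>R\<^esub> [^]\<^bsub>R\<^esub> (1::nat) \<in> carrier R" by simp
  ultimately show ?thesis
    unfolding graded_radically_principal_ideal_iff[OF graded_ideal_carrier]
    using one_homogeneous zero_less_one by blast
qed

section \<open>Zorn's lemma and primeness of maximal counterexamples\<close>

text \<open>Components of an element stay in the chain member that contains it. The chain must be
  nonempty because the empty union is not an ideal.\<close>

lemma graded_ideal_Union_chain:
  assumes "C \<noteq> {}" and chain: "subset.chain {I. graded_ideal G R A I} C"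
  shows "graded_ideal G R A (\<Union>C)"
proof (rule graded_idealI)
  have gr: "graded_ideal G R A I" if "I \<in> C" for I
    using chain that by (auto simp: subset_chain_def)
  then have "subset.chain {I. ideal I R} C"
    using chain graded_idealD by (auto simp: subset_chain_def)
  from R.chain_Union_is_ideal[OF this] \<open>C \<noteq> {}\<close> show "ideal (\<Union>C) R" by simp
  show "component G R A x g \<in> \<Union>C" if "x \<in> \<Union>C" "g \<in> carrier G" for x g
    using that gr graded_ideal_component by blast
qed

lemma graded_prime_if_maximal:
  assumes P: "graded_ideal G R A P" and not_principal: "\<not> graded_radically_principal_ideal G R A P"
    and max: "\<And>I. \<lbrakk>graded_ideal G R A I; P \<subset> I\<rbrakk> \<Longrightarrow> graded_radically_principal_ideal G R A I"
  shows "graded_prime_ideal G R A P"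
  unfolding graded_prime_ideal_def
proof (intro conjI ballI impI)
  interpret P: ideal P R using P by (rule graded_idealD)
  show "P \<noteq> carrier R" using not_principal graded_radically_principal_carrier by blast
  \<comment> \<open>Maximality yields the last clause for powers in \<open>P + (x)\<close>. It is
    recorded only for powers in the smaller \<open>P\<close>, which is the ideal to be radically
    generated in the end.\<close>
  have generator: "\<exists>a \<in> homogeneous_elements G A. (\<exists>n::nat. n > 0 \<and> a [^]\<^bsub>R\<^esub> n \<in> P <+>\<^bsub>R\<^esub> PIdl\<^bsub>R\<^esub> x) \<and>
      (\<forall>z \<in> homogeneous_elements G A. (\<exists>n::nat. n > 0 \<and> z [^]\<^bsub>R\<^esub> n \<in> P) \<longrightarrow>
        (\<exists>n::nat. n > 0 \<and> z [^]\<^bsub>R\<^esub> n \<in> PIdl\<^bsub>R\<^esub> a))"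
    if x: "x \<in> homogeneous_elements G A" "x \<notin> P" for x
  proof -
    let ?J = "P <+>\<^bsub>R\<^esub> PIdl\<^bsub>R\<^esub> x"
    have xR: "x \<in> carrier R" using x(1) by (rule homogeneous_closed)
    have xx: "x = \<zero>\<^bsub>R\<^esub> \<oplus>\<^bsub>R\<^esub> \<one>\<^bsub>R\<^esub> \<otimes>\<^bsub>R\<^esub> x"
      using xR by simp
    have "p \<in> ?J" if "p \<in> P" for p
    proof -
      have "p = p \<oplus>\<^bsub>R\<^esub> \<zero>\<^bsub>R\<^esub> \<otimes>\<^bsub>R\<^esub> x" using that xR P.Icarr by simp
      with that show ?thesis unfolding set_add_def' cgenideal_def by blast
    qed
    moreover have "x \<in> ?J"
      using xx P.zero_closed R.one_closed unfolding set_add_def' cgenideal_def by blast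
    ultimately have PJ: "P \<subset> ?J" using x(2) by blast
    have J: "graded_ideal G R A ?J" using P x(1) by (rule graded_ideal_add_principal)
    from max[OF J PJ] show ?thesis
      unfolding graded_radically_principal_ideal_iff[OF J] using PJ by blast
  qed
  fix x y assume x: "x \<in> homogeneous_elements G A" and y: "y \<in> homogeneous_elements G A"
    and xy: "x \<otimes>\<^bsub>R\<^esub> y \<in> P"
  show "x \<in> P \<or> y \<in> P"
  proof (rule ccontr)
    assume "\<not> (x \<in> P \<or> y \<in> P)"
    then obtain a b and n m :: nat where a: "a \<in> homogeneous_elements G A" and n: "n > 0"
      and an: "a [^]\<^bsub>R\<^esub> n \<in> P <+>\<^bsub>R\<^esub> PIdl\<^bsub>R\<^esub> x"
      and a_gen: "\<And>z k. \<lbrakk>z \<in> homogeneous_elements G A; (k::nat) > 0; z [^]\<^bsub>R\<^esub> k \<in> P\<rbrakk> \<Longrightarrow>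
        \<exists>n::nat. n > 0 \<and> z [^]\<^bsub>R\<^esub> n \<in> PIdl\<^bsub>R\<^esub> a"
      and b: "b \<in> homogeneous_elements G A" and m: "m > 0"
      and bm: "b [^]\<^bsub>R\<^esub> m \<in> P <+>\<^bsub>R\<^esub> PIdl\<^bsub>R\<^esub> y"
      and b_gen: "\<And>z k. \<lbrakk>z \<in> homogeneous_elements G A; (k::nat) > 0; z [^]\<^bsub>R\<^esub> k \<in> P\<rbrakk> \<Longrightarrow>
        \<exists>n::nat. n > 0 \<and> z [^]\<^bsub>R\<^esub> n \<in> PIdl\<^bsub>R\<^esub> b"
      using generator[OF x] generator[OF y] by metis
    note closed = x[THEN homogeneous_closed] y[THEN homogeneous_closed]
      a[THEN homogeneous_closed] b[THEN homogeneous_closed]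
    \<comment> \<open>The exponents \<open>n\<close> and \<open>m\<close> may differ. Raising
      \<open>a b\<close> to the power \<open>n + m\<close> leaves \<open>a^n b^m\<close> as a
      factor, which already lies in \<open>P\<close>.\<close>
    have "(a \<otimes>\<^bsub>R\<^esub> b) [^]\<^bsub>R\<^esub> (n + m) \<in> P"
    proof -
      obtain p r q s where p: "p \<in> P" and r: "r \<in> carrier R" and q: "q \<in> P" and s: "s \<in> carrier R"
        and an': "a [^]\<^bsub>R\<^esub> n = p \<oplus>\<^bsub>R\<^esub> r \<otimes>\<^bsub>R\<^esub> x" and bm': "b [^]\<^bsub>R\<^esub> m = q \<oplus>\<^bsub>R\<^esub> s \<otimes>\<^bsub>R\<^esub> y"
        using an bm by (auto simp: set_add_def' cgenideal_def)
      note [simp] = closed r s P.Icarr[OF p] P.Icarr[OF q]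
      \<comment> \<open>In the expansion every term contains \<open>p\<close>, \<open>q\<close> or
        the product of \<open>x\<close> and \<open>y\<close>, all of them in
        \<open>P\<close>.\<close>
      have "a [^]\<^bsub>R\<^esub> n \<otimes>\<^bsub>R\<^esub> b [^]\<^bsub>R\<^esub> m =
          p \<otimes>\<^bsub>R\<^esub> (q \<oplus>\<^bsub>R\<^esub> s \<otimes>\<^bsub>R\<^esub> y) \<oplus>\<^bsub>R\<^esub> (r \<otimes>\<^bsub>R\<^esub> x \<otimes>\<^bsub>R\<^esub> q \<oplus>\<^bsub>R\<^esub> r \<otimes>\<^bsub>R\<^esub> s \<otimes>\<^bsub>R\<^esub> (x \<otimes>\<^bsub>R\<^esub> y))"
        unfolding an' bm' by (simp add: R.l_distr R.r_distr R.m_ac R.a_ac)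
      also have "\<dots> \<in> P"
        using p q xy by (intro P.a_closed) (simp_all add: P.I_l_closed P.I_r_closed)
      finally have "a [^]\<^bsub>R\<^esub> n \<otimes>\<^bsub>R\<^esub> b [^]\<^bsub>R\<^esub> m \<in> P" .
      moreover have "(a \<otimes>\<^bsub>R\<^esub> b) [^]\<^bsub>R\<^esub> (n + m) =
          (a [^]\<^bsub>R\<^esub> m \<otimes>\<^bsub>R\<^esub> b [^]\<^bsub>R\<^esub> n) \<otimes>\<^bsub>R\<^esub> (a [^]\<^bsub>R\<^esub> n \<otimes>\<^bsub>R\<^esub> b [^]\<^bsub>R\<^esub> m)"
        by (simp add: R.nat_pow_distrib R.nat_pow_mult[symmetric] R.m_ac)
      ultimately show ?thesis by (simp add: P.I_l_closed)
    qed
    moreover have "\<exists>k::nat. k > 0 \<and> z [^]\<^bsub>R\<^esub> k \<in> PIdl\<^bsub>R\<^esub> (a \<otimes>\<^bsub>R\<^esub> b)"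
      if z: "z \<in> homogeneous_elements G A" and k: "(k::nat) > 0" "z [^]\<^bsub>R\<^esub> k \<in> P" for z k
    proof -
      have zR: "z \<in> carrier R" using z by (rule homogeneous_closed)
      obtain i j :: nat and r s where i: "i > 0" and r: "r \<in> carrier R" "z [^]\<^bsub>R\<^esub> i = r \<otimes>\<^bsub>R\<^esub> a"
        and s: "s \<in> carrier R" "z [^]\<^bsub>R\<^esub> j = s \<otimes>\<^bsub>R\<^esub> b"
        using a_gen[OF z k] b_gen[OF z k] unfolding cgenideal_def by blast
      \<comment> \<open>Adding exponents multiplies a multiple of \<open>a\<close> by a multiple of
        \<open>b\<close>, giving a multiple of their product.\<close>
      have "z [^]\<^bsub>R\<^esub> (i + j) = (r \<otimes>\<^bsub>R\<^esub> a) \<otimes>\<^bsub>R\<^esub> (s \<otimes>\<^bsub>R\<^esub> b)"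
        using zR r s by (simp add: R.nat_pow_mult[symmetric])
      also have "\<dots> = (r \<otimes>\<^bsub>R\<^esub> s) \<otimes>\<^bsub>R\<^esub> (a \<otimes>\<^bsub>R\<^esub> b)"
        using r(1) s(1) closed by (simp add: R.m_ac)
      finally have "z [^]\<^bsub>R\<^esub> (i + j) \<in> PIdl\<^bsub>R\<^esub> (a \<otimes>\<^bsub>R\<^esub> b)"
        using r(1) s(1) R.m_closed unfolding cgenideal_def by blast
      with i show ?thesis by (intro exI[of _ "i + j"]) simp
    qed
    ultimately have "graded_radically_principal_ideal G R A P"
      unfolding graded_radically_principal_ideal_iff[OF P]
      using homogeneous_mult[OF a b] n by (intro bexI[of _ "a \<otimes>\<^bsub>R\<^esub> b"]) auto
    with not_principal show False by contradiction
  qed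
qed (rule P)

lemma ex_maximal_not_graded_radically_principal:
  assumes "graded_ideal G R A I" "\<not> graded_radically_principal_ideal G R A I"
  obtains P where "graded_ideal G R A P" "\<not> graded_radically_principal_ideal G R A P"
    "\<And>J. \<lbrakk>graded_ideal G R A J; P \<subset> J\<rbrakk> \<Longrightarrow> graded_radically_principal_ideal G R A J"
proof -
  let ?N = "{I. graded_ideal G R A I \<and> \<not> graded_radically_principal_ideal G R A I}"
  \<comment> \<open>This form of Zorn's lemma asks for the union of nonempty chains only;
    \<open>?N\<close> itself is nonempty because of \<open>I\<close>.\<close>
  have "\<exists>P\<in>?N. \<forall>J\<in>?N. P \<subseteq> J \<longrightarrow> J = P"
  proof (rule subset_Zorn_nonempty)
    fix C assume ne: "C \<noteq> {}" and chain: "subset.chain ?N C"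
    have gr: "graded_ideal G R A J" and nrp: "\<not> graded_radically_principal_ideal G R A J"
      if "J \<in> C" for J
      using chain that by (auto simp: subset_chain_def)
    have U: "graded_ideal G R A (\<Union>C)"
      using graded_ideal_Union_chain[OF ne] chain by (auto simp: subset_chain_def)
    have False if U_principal: "graded_radically_principal_ideal G R A (\<Union>C)"
    proof -
      obtain c and n :: nat and J where c: "c \<in> homogeneous_elements G A"
        and J: "J \<in> C" and n: "n > 0" "c [^]\<^bsub>R\<^esub> n \<in> J"
        and gen: "\<forall>z \<in> homogeneous_elements G A. (\<exists>n::nat. n > 0 \<and> z [^]\<^bsub>R\<^esub> n \<in> \<Union>C) \<longrightarrow>
          (\<exists>n::nat. n > 0 \<and> z [^]\<^bsub>R\<^esub> n \<in> PIdl\<^bsub>R\<^esub> c)"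
        using U_principal unfolding graded_radically_principal_ideal_iff[OF U] by blast
      \<comment> \<open>The clause \<open>gen\<close> passes from the union to its subset
        \<open>J\<close>, so the same \<open>c\<close> serves.\<close>
      then have "graded_radically_principal_ideal G R A J"
        unfolding graded_radically_principal_ideal_iff[OF gr[OF J]] by blast
      with nrp[OF J] show False by contradiction
    qed
    with U show "\<Union>C \<in> ?N" by blast
  qed (use assms in blast)
  then show thesis using that by blast
qed

end

theorem theorem2p6:
  fixes G :: "('g, 'n) monoid_scheme"
    and R :: "('r, 'm) ring_scheme"
    and A :: "'g \<Rightarrow> 'r set"
  assumes "graded_ring G R A"
  shows "graded_radically_principal_ring G R A \<longleftrightarrow>
    (\<forall>P. graded_prime_ideal G R A P \<longrightarrow> graded_radically_principal_ideal G R A P)"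
proof
  assume "graded_radically_principal_ring G R A"
  then show "\<forall>P. graded_prime_ideal G R A P \<longrightarrow> graded_radically_principal_ideal G R A P"
    by (simp add: graded_radically_principal_ring_def graded_prime_ideal_def)
next
  interpret graded_ring G R A by fact
  assume "\<forall>P. graded_prime_ideal G R A P \<longrightarrow> graded_radically_principal_ideal G R A P"
  \<comment> \<open>A maximal counterexample would be graded prime, hence graded radically principal
    by assumption, a contradiction.\<close>
  then show "graded_radically_principal_ring G R A"
    unfolding graded_radically_principal_ring_def
    using ex_maximal_not_graded_radically_principal graded_prime_if_maximal by metis
qed

end
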